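(* Let $T\in(0,\infty)$, let $T_\eta(\gamma_0)\subset M$ be the $\eta$-tube around the classical trajectory $\gamma_0$, and let $X=(X_t)_{t\in[0,T]}$ be the diffusion of $T_\eta(\gamma_0)$; for $x\in T_\eta(\gamma_0)$ let $\mathbb{E}_{0,x}$ denote expectation with respect to the law $\mathbb{P}_{0,x}$ of $X$ started from $X_0=x$ at time $0$. Let $V_E:[0,T]\times T_\eta(\gamma_0)\to\mathbb{R}$ be a Borel measurable function (the Euclidean density of the action) such that $$\sup_{(t,x)\in[0,T]\times T_\eta(\gamma_0)}|V_E(t,x)|=:C<\infty,$$ and let $f:T_\eta(\gamma_0)\to\mathbb{C}$ be bounded and Borel. For $\theta\in\mathbb{C}$ and $x\in T_\eta(\gamma_0)$ put $$u_\theta(0,x):=\mathbb{E}_{0,x}\!\left[f(X_T)\exp\!\Big(-\theta\int_0^T V_E(t,X_t)\,dt\Big)\right].$$ Then for every $x\in T_\eta(\gamma_0)$ the expectation defining $u_\theta(0,x)$ exists and is finite for all $\theta\in\mathbb{C}$, and the map $\theta\mapsto u_\theta(0,x)$ extends to an entire function on $\mathbb{C}$.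
   Context: $(M,g)$ is a compact smooth Riemannian manifold and $\gamma_0$ is a $C^2$ curve in $M$ (the classical trajectory) joining two fixed points. For sufficiently small $\eta>0$, the $\eta$-tube is $$T_\eta(\gamma_0)=\{\exp_{\gamma_0(t)}(\nu):\ t\in[0,T],\ \nu\in N_{\gamma_0(t)}\gamma_0,\ |\nu|_g<\eta\},$$ where $\exp$ is the Riemannian exponential map and $N_{\gamma_0(t)}\gamma_0=\{v\in T_{\gamma_0(t)}M:\ g(\dot\gamma_0(t),v)=0\}$. The diffusion of the tube is the Markov process $X$ with continuous paths staying in the tube whose time-dependent generator, written in parallel-frame coordinates of the tube, is $G_tf=\langle b_t,\nabla f\rangle+\frac{\sigma^2}{2}\nabla^2 f$, where $\nabla^2$ is the Laplacian, $b_t=-\frac{1}{\sigma^2}\nabla U_t$, $U_t(x)=\frac12\chi(t)|x|^2+E_c(|x|)$, and $E_c:[0,\eta)\to\mathbb{R}$ is a $C^1$, locally Lipschitz barrier confining the process to the tube. All paths of $X$ are continuous, and $X_t\in T_\eta(\gamma_0)$ for all $t\in[0,T]$. *)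

theory Defs
  imports "HOL-Probability.Probability" "HOL-Complex_Analysis.Complex_Analysis"
begin

section \<open>Smooth manifolds and tangent vectors\<close>

text \<open>In finite dimension, continuity of all directional derivatives of order at most \<open>k\<close>
  is the usual notion of class \<open>C\<^sup>k\<close>. The set \<open>S\<close> is meant to be open.\<close>

fun Ck_on :: "nat \<Rightarrow> 'a::euclidean_space set \<Rightarrow> ('a \<Rightarrow> 'b::real_normed_vector) \<Rightarrow> bool" where
  "Ck_on 0 S f \<longleftrightarrow> continuous_on S f"
| "Ck_on (Suc k) S f \<longleftrightarrow>
     (\<forall>x\<in>S. f differentiable (at x)) \<and> (\<forall>v. Ck_on k S (\<lambda>x. frechet_derivative f (at x) v))"

definition smooth_on :: "'a::euclidean_space set \<Rightarrow> ('a \<Rightarrow> 'b::real_normed_vector) \<Rightarrow> bool" where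
  "smooth_on S f \<longleftrightarrow> (\<forall>k. Ck_on k S f)"

type_synonym ('m, 'e) chart = "'m set \<times> ('m \<Rightarrow> 'e)"

abbreviation chart_inv :: "('m, 'e) chart \<Rightarrow> 'e \<Rightarrow> 'm" where
  "chart_inv c \<equiv> the_inv_into (fst c) (snd c)"

text \<open>The manifold is the whole type \<open>'m\<close>; its smooth structure is given by an atlas of charts
  with values in the model space \<open>'e\<close>.\<close>

definition smooth_atlas ::
    "('m::{t2_space,second_countable_topology}, 'e::euclidean_space) chart set \<Rightarrow> bool" where
  "smooth_atlas A \<longleftrightarrow>
     (\<forall>c\<in>A. open (fst c) \<and> open (snd c ` fst c) \<and>
            homeomorphism (fst c) (snd c ` fst c) (snd c) (chart_inv c)) \<and>
     (\<Union>c\<in>A. fst c) = UNIV \<and>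
     (\<forall>c\<in>A. \<forall>d\<in>A. smooth_on (snd c ` (fst c \<inter> fst d)) (snd d \<circ> chart_inv c))"

definition chart_change ::
    "('m, 'e::euclidean_space) chart \<Rightarrow> ('m, 'e) chart \<Rightarrow> 'm \<Rightarrow> 'e \<Rightarrow> 'e" where
  "chart_change c d p = frechet_derivative (snd d \<circ> chart_inv c) (at (snd c p))"

text \<open>A tangent vector at \<open>p\<close> is the family of its component vectors in all charts around \<open>p\<close>,
  subject to the transformation law; it is set to 0 at all other arguments, so that equality of
  tangent vectors is equality of functions.\<close>

type_synonym ('m, 'e) tvec = "('m, 'e) chart \<Rightarrow> 'e"

definition tangent_space ::
    "('m, 'e::euclidean_space) chart set \<Rightarrow> 'm \<Rightarrow> ('m, 'e) tvec set" where
  "tangent_space A p =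
     {v. (\<forall>c\<in>A. \<forall>d\<in>A. p \<in> fst c \<and> p \<in> fst d \<longrightarrow> v d = chart_change c d p (v c)) \<and>
         (\<forall>c. \<not> (c \<in> A \<and> p \<in> fst c) \<longrightarrow> v c = 0)}"

definition tvec_of ::
    "('m, 'e::euclidean_space) chart set \<Rightarrow> ('m, 'e) chart \<Rightarrow> 'm \<Rightarrow> 'e \<Rightarrow> ('m, 'e) tvec" where
  "tvec_of A c p u = (\<lambda>d. if d \<in> A \<and> p \<in> fst d then chart_change c d p u else 0)"

section \<open>Riemannian metrics, geodesics and the exponential map\<close>

type_synonym ('m, 'e) metric = "'m \<Rightarrow> ('m, 'e) tvec \<Rightarrow> ('m, 'e) tvec \<Rightarrow> real"

definition metric_in_chart ::
    "('m, 'e::euclidean_space) chart set \<Rightarrow> ('m, 'e) metric \<Rightarrow> ('m, 'e) chart \<Rightarrow>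
     'e \<Rightarrow> 'e \<Rightarrow> 'e \<Rightarrow> real" where
  "metric_in_chart A g c x u w =
     g (chart_inv c x) (tvec_of A c (chart_inv c x) u) (tvec_of A c (chart_inv c x) w)"

definition riemannian_metric ::
    "('m, 'e::euclidean_space) chart set \<Rightarrow> ('m, 'e) metric \<Rightarrow> bool" where
  "riemannian_metric A g \<longleftrightarrow>
     (\<forall>p. \<forall>u\<in>tangent_space A p. \<forall>v\<in>tangent_space A p.
        g p u v = g p v u \<and>
        (\<forall>w\<in>tangent_space A p. \<forall>a b. g p (\<lambda>d. a *\<^sub>R u d + b *\<^sub>R v d) w = a * g p u w + b * g p v w) \<and>
        (u \<noteq> (\<lambda>_. 0) \<longrightarrow> g p u u > 0)) \<and>
     (\<forall>c\<in>A. \<forall>u w. smooth_on (snd c ` fst c) (\<lambda>x. metric_in_chart A g c x u w))"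

definition tnorm :: "('m, 'e) metric \<Rightarrow> 'm \<Rightarrow> ('m, 'e) tvec \<Rightarrow> real" where
  "tnorm g p v = sqrt (g p v v)"

text \<open>Christoffel symbols of the first kind (all indices lowered), as a trilinear form in the
  components: \<open>christoffel A g c x u v w = g(\<nabla>\<^sub>u V, w)\<close> at \<open>x\<close> for the vector field \<open>V\<close> with
  constant components \<open>v\<close> in the chart \<open>c\<close>.\<close>

definition christoffel ::
    "('m, 'e::euclidean_space) chart set \<Rightarrow> ('m, 'e) metric \<Rightarrow> ('m, 'e) chart \<Rightarrow>
     'e \<Rightarrow> 'e \<Rightarrow> 'e \<Rightarrow> 'e \<Rightarrow> real" where
  "christoffel A g c x u v w =
     (frechet_derivative (\<lambda>z. metric_in_chart A g c z v w) (at x) u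
    + frechet_derivative (\<lambda>z. metric_in_chart A g c z u w) (at x) v
    - frechet_derivative (\<lambda>z. metric_in_chart A g c z u v) (at x) w) / 2"

definition chart_vel ::
    "('m, 'e::euclidean_space) chart \<Rightarrow> (real \<Rightarrow> 'm) \<Rightarrow> real set \<Rightarrow> real \<Rightarrow> 'e" where
  "chart_vel c \<gamma> I t = vector_derivative (\<lambda>s. snd c (\<gamma> s)) (at t within I)"

definition chart_acc ::
    "('m, 'e::euclidean_space) chart \<Rightarrow> (real \<Rightarrow> 'm) \<Rightarrow> real set \<Rightarrow> real \<Rightarrow> 'e" where
  "chart_acc c \<gamma> I t = vector_derivative (chart_vel c \<gamma> I) (at t within I)"

definition velocity ::
    "('m, 'e::euclidean_space) chart set \<Rightarrow> (real \<Rightarrow> 'm) \<Rightarrow> real set \<Rightarrow> real \<Rightarrow> ('m, 'e) tvec" where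
  "velocity A \<gamma> I t = (\<lambda>c. if c \<in> A \<and> \<gamma> t \<in> fst c then chart_vel c \<gamma> I t else 0)"

definition C2_curve ::
    "('m::topological_space, 'e::euclidean_space) chart set \<Rightarrow> (real \<Rightarrow> 'm) \<Rightarrow> real set \<Rightarrow> bool" where
  "C2_curve A \<gamma> I \<longleftrightarrow>
     continuous_on I \<gamma> \<and>
     (\<forall>c\<in>A.
        (\<forall>t\<in>I. \<gamma> t \<in> fst c \<longrightarrow>
           (\<lambda>s. snd c (\<gamma> s)) differentiable (at t within I) \<and>
           chart_vel c \<gamma> I differentiable (at t within I)) \<and>
        continuous_on {t\<in>I. \<gamma> t \<in> fst c} (chart_acc c \<gamma> I))"

text \<open>The geodesic equation, tested against an arbitrary vector \<open>w\<close>.\<close>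

definition geodesic ::
    "('m::topological_space, 'e::euclidean_space) chart set \<Rightarrow> ('m, 'e) metric \<Rightarrow>
     (real \<Rightarrow> 'm) \<Rightarrow> real set \<Rightarrow> bool" where
  "geodesic A g c I \<longleftrightarrow>
     C2_curve A c I \<and>
     (\<forall>k\<in>A. \<forall>t\<in>I. c t \<in> fst k \<longrightarrow>
        (\<forall>w. metric_in_chart A g k (snd k (c t)) (chart_acc k c I t) w
           + christoffel A g k (snd k (c t)) (chart_vel k c I t) (chart_vel k c I t) w = 0))"

definition riem_exp ::
    "('m::topological_space, 'e::euclidean_space) chart set \<Rightarrow> ('m, 'e) metric \<Rightarrow>
     'm \<Rightarrow> ('m, 'e) tvec \<Rightarrow> 'm" where
  "riem_exp A g p v =
     (THE q. \<exists>c. geodesic A g c {0..1} \<and> c 0 = p \<and> velocity A c {0..1} 0 = v \<and> c 1 = q)"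

section \<open>The tube and its parallel-frame coordinates\<close>

definition normal_space ::
    "('m, 'e::euclidean_space) chart set \<Rightarrow> ('m, 'e) metric \<Rightarrow> (real \<Rightarrow> 'm) \<Rightarrow> real \<Rightarrow> real \<Rightarrow>
     ('m, 'e) tvec set" where
  "normal_space A g \<gamma> T t =
     {v \<in> tangent_space A (\<gamma> t). g (\<gamma> t) (velocity A \<gamma> {0..T} t) v = 0}"

definition tube ::
    "('m::topological_space, 'e::euclidean_space) chart set \<Rightarrow> ('m, 'e) metric \<Rightarrow> (real \<Rightarrow> 'm) \<Rightarrow>
     real \<Rightarrow> real \<Rightarrow> 'm set" where
  "tube A g \<gamma> T \<eta> =
     {riem_exp A g (\<gamma> t) \<nu> | t \<nu>.
        t \<in> {0..T} \<and> \<nu> \<in> normal_space A g \<gamma> T t \<and> tnorm g (\<gamma> t) \<nu> < \<eta>}"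

text \<open>The transverse coordinate space is the coordinate subspace \<open>span K\<close> of the model space,
  where \<open>K \<subseteq> Basis\<close> indexes the frame: for a regular curve in an \<open>n\<close>-dimensional manifold,
  \<open>K\<close> has \<open>n - 1\<close> elements, possibly none.\<close>

definition frame_comb ::
    "('e::euclidean_space) set \<Rightarrow> ('e \<Rightarrow> real \<Rightarrow> ('m, 'e) tvec) \<Rightarrow> real \<Rightarrow> 'e \<Rightarrow> ('m, 'e) tvec" where
  "frame_comb K e t y = (\<lambda>d. \<Sum>b\<in>K. (y \<bullet> b) *\<^sub>R e b t d)"

text \<open>An orthonormal frame of the normal bundle that is parallel for the normal connection: the
  covariant derivative of each \<open>e b\<close> along \<open>\<gamma>\<close> has no normal component. Levi-Civita parallel
  fields need not stay normal to \<open>\<gamma>\<close> unless \<open>\<gamma>\<close> is a geodesic; if it is one, the two notions of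
  parallelism agree on normal fields.\<close>

definition parallel_frame ::
    "('m, 'e::euclidean_space) chart set \<Rightarrow> ('m, 'e) metric \<Rightarrow> (real \<Rightarrow> 'm) \<Rightarrow> real \<Rightarrow>
     'e set \<Rightarrow> ('e \<Rightarrow> real \<Rightarrow> ('m, 'e) tvec) \<Rightarrow> bool" where
  "parallel_frame A g \<gamma> T K e \<longleftrightarrow>
     K \<subseteq> Basis \<and>
     (\<forall>t\<in>{0..T}.
        (\<forall>b\<in>K. e b t \<in> normal_space A g \<gamma> T t) \<and>
        (\<forall>b\<in>K. \<forall>b'\<in>K. g (\<gamma> t) (e b t) (e b' t) = (if b = b' then 1 else 0)) \<and>
        (\<forall>\<nu>\<in>normal_space A g \<gamma> T t. \<exists>y\<in>span K. \<nu> = frame_comb K e t y)) \<and>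
     (\<forall>b\<in>K. \<forall>c\<in>A. \<forall>t\<in>{0..T}. \<gamma> t \<in> fst c \<longrightarrow>
        (\<lambda>s. e b s c) differentiable (at t within {0..T}) \<and>
        (\<forall>\<nu>\<in>normal_space A g \<gamma> T t.
           metric_in_chart A g c (snd c (\<gamma> t))
             (vector_derivative (\<lambda>s. e b s c) (at t within {0..T})) (\<nu> c)
         + christoffel A g c (snd c (\<gamma> t)) (chart_vel c \<gamma> {0..T} t) (e b t c) (\<nu> c) = 0))"

definition coord_ball :: "('e::euclidean_space) set \<Rightarrow> real \<Rightarrow> 'e set" where
  "coord_ball K \<eta> = {y \<in> span K. norm y < \<eta>}"

definition tube_param ::
    "('m::topological_space, 'e::euclidean_space) chart set \<Rightarrow> ('m, 'e) metric \<Rightarrow> (real \<Rightarrow> 'm) \<Rightarrow>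
     'e set \<Rightarrow> ('e \<Rightarrow> real \<Rightarrow> ('m, 'e) tvec) \<Rightarrow> real \<Rightarrow> 'e \<Rightarrow> 'm" where
  "tube_param A g \<gamma> K e a y = riem_exp A g (\<gamma> a) (frame_comb K e a y)"

section \<open>The generator\<close>

definition pderiv_at :: "('e::euclidean_space \<Rightarrow> real) \<Rightarrow> 'e \<Rightarrow> 'e \<Rightarrow> real" where
  "pderiv_at f b y = deriv (\<lambda>h. f (y + h *\<^sub>R b)) 0"

definition grad :: "('e::euclidean_space) set \<Rightarrow> ('e \<Rightarrow> real) \<Rightarrow> 'e \<Rightarrow> 'e" where
  "grad K f y = (\<Sum>b\<in>K. pderiv_at f b y *\<^sub>R b)"

definition laplacian :: "('e::euclidean_space) set \<Rightarrow> ('e \<Rightarrow> real) \<Rightarrow> 'e \<Rightarrow> real" where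
  "laplacian K f y = (\<Sum>b\<in>K. pderiv_at (pderiv_at f b) b y)"

definition potential :: "(real \<Rightarrow> real) \<Rightarrow> (real \<Rightarrow> real) \<Rightarrow> real \<Rightarrow> 'e::euclidean_space \<Rightarrow> real" where
  "potential chi Ec t y = chi t * (norm y)\<^sup>2 / 2 + Ec (norm y)"

definition drift ::
    "('e::euclidean_space) set \<Rightarrow> real \<Rightarrow> (real \<Rightarrow> real) \<Rightarrow> (real \<Rightarrow> real) \<Rightarrow> real \<Rightarrow> 'e \<Rightarrow> 'e" where
  "drift K \<sigma> chi Ec t y = (- 1 / \<sigma>\<^sup>2) *\<^sub>R grad K (potential chi Ec t) y"

definition tube_generator ::
    "('e::euclidean_space) set \<Rightarrow> real \<Rightarrow> (real \<Rightarrow> real) \<Rightarrow> (real \<Rightarrow> real) \<Rightarrow> real \<Rightarrow>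
     ('e \<Rightarrow> real) \<Rightarrow> 'e \<Rightarrow> real" where
  "tube_generator K \<sigma> chi Ec t f y =
     drift K \<sigma> chi Ec t y \<bullet> grad K f y + \<sigma>\<^sup>2 / 2 * laplacian K f y"

definition barrier :: "real \<Rightarrow> (real \<Rightarrow> real) \<Rightarrow> bool" where
  "barrier \<eta> Ec \<longleftrightarrow>
     (\<exists>Ec'. continuous_on {0..<\<eta>} Ec' \<and>
        (\<forall>r\<in>{0..<\<eta>}. (Ec has_real_derivative Ec' r) (at r within {0..<\<eta>}))) \<and>
     (\<forall>r\<in>{0..<\<eta>}. \<exists>\<epsilon>>0. \<exists>L. L-lipschitz_on (cball r \<epsilon> \<inter> {0..<\<eta>}) Ec)"

definition test_function :: "('e::euclidean_space) set \<Rightarrow> real \<Rightarrow> ('e \<Rightarrow> real) \<Rightarrow> bool" where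
  "test_function K \<eta> f \<longleftrightarrow>
     Ck_on 2 UNIV f \<and> (\<exists>r<\<eta>. \<forall>y\<in>span K. norm y \<ge> r \<longrightarrow> f y = 0)"

section \<open>Markov processes and the diffusion of the tube\<close>

definition path_filtration ::
    "'w measure \<Rightarrow> (real \<Rightarrow> 'w \<Rightarrow> 'm::topological_space) \<Rightarrow> real \<Rightarrow> real \<Rightarrow> 'w measure" where
  "path_filtration N X s t =
     sigma (space N) {X r -` B \<inter> space N | r B. r \<in> {s..t} \<and> B \<in> sets borel}"

text \<open>A time-inhomogeneous Markov process on \<open>[0,T]\<close> with state space \<open>S\<close> and continuous paths.
  The measure \<open>N\<close> only supplies the measurable sample space; \<open>P s x\<close> is the law under which
  the process starts from \<open>x\<close> at time \<open>s\<close>.\<close>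

definition continuous_markov_process ::
    "real \<Rightarrow> 'm::topological_space set \<Rightarrow> 'w measure \<Rightarrow> (real \<Rightarrow> 'm \<Rightarrow> 'w measure) \<Rightarrow>
     (real \<Rightarrow> 'w \<Rightarrow> 'm) \<Rightarrow> bool" where
  "continuous_markov_process T S N P X \<longleftrightarrow>
     (\<forall>t\<in>{0..T}. X t \<in> measurable N borel) \<and>
     (\<forall>\<omega>\<in>space N. continuous_on {0..T} (\<lambda>t. X t \<omega>) \<and> (\<forall>t\<in>{0..T}. X t \<omega> \<in> S)) \<and>
     (\<forall>s\<in>{0..T}. \<forall>x\<in>S.
        prob_space (P s x) \<and> sets (P s x) = sets N \<and> (AE \<omega> in P s x. X s \<omega> = x)) \<and>
     (\<forall>s\<in>{0..T}. \<forall>t\<in>{s..T}. \<forall>B\<in>sets borel.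
        (\<lambda>x. measure (P s x) (X t -` B \<inter> space N)) \<in> borel_measurable (restrict_space borel S)) \<and>
     (\<forall>s\<in>{0..T}. \<forall>x\<in>S. \<forall>t\<in>{s..T}. \<forall>u\<in>{t..T}. \<forall>B\<in>sets borel.
        AE \<omega> in P s x.
          real_cond_exp (P s x) (path_filtration N X s t) (indicator (X u -` B \<inter> space N)) \<omega>
          = measure (P t (X t \<omega>)) (X u -` B \<inter> space N))"

text \<open>The generator at time \<open>s\<close> is the right derivative at \<open>h = 0\<close> of \<open>E\<^bsub>s,x\<^esub> F(X\<^bsub>s+h\<^esub>)\<close>. It acts on
  functions \<open>F\<close> on the tube that are given in parallel-frame coordinates by a function \<open>f\<close> of
  the transverse coordinate \<open>y\<close>, the only coordinate that occurs in its formula; the motion of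
  the curve parameter \<open>a\<close> is not prescribed. The differentiability proviso only
  concerns \<open>y = 0\<close>, where the gradient of the potential does not exist if \<open>Ec\<close> has nonzero
  slope at 0.\<close>

definition tube_diffusion ::
    "('m::topological_space, 'e::euclidean_space) chart set \<Rightarrow> ('m, 'e) metric \<Rightarrow> (real \<Rightarrow> 'm) \<Rightarrow>
     real \<Rightarrow> real \<Rightarrow> 'e set \<Rightarrow> ('e \<Rightarrow> real \<Rightarrow> ('m, 'e) tvec) \<Rightarrow>
     real \<Rightarrow> (real \<Rightarrow> real) \<Rightarrow> (real \<Rightarrow> real) \<Rightarrow>
     'w measure \<Rightarrow> (real \<Rightarrow> 'm \<Rightarrow> 'w measure) \<Rightarrow> (real \<Rightarrow> 'w \<Rightarrow> 'm) \<Rightarrow> bool" where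
  "tube_diffusion A g \<gamma> T \<eta> K e \<sigma> chi Ec N P X \<longleftrightarrow>
     continuous_markov_process T (tube A g \<gamma> T \<eta>) N P X \<and>
     (\<forall>f F. test_function K \<eta> f \<longrightarrow>
        (\<forall>a\<in>{0..T}. \<forall>y\<in>coord_ball K \<eta>. F (tube_param A g \<gamma> K e a y) = f y) \<longrightarrow>
        (\<forall>s\<in>{0..<T}. \<forall>a\<in>{0..T}. \<forall>y\<in>coord_ball K \<eta>.
           (\<forall>b\<in>K. (\<lambda>h. potential chi Ec s (y + h *\<^sub>R b)) differentiable (at 0)) \<longrightarrow>
           ((\<lambda>h. ((\<integral>\<omega>. F (X (s + h) \<omega>) \<partial>P s (tube_param A g \<gamma> K e a y)) - f y) / h)
              \<longlongrightarrow> tube_generator K \<sigma> chi Ec s f y) (at_right 0)))"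

definition feynman_kac_integrand ::
    "real \<Rightarrow> (real \<Rightarrow> 'm \<Rightarrow> real) \<Rightarrow> ('m \<Rightarrow> complex) \<Rightarrow> (real \<Rightarrow> 'w \<Rightarrow> 'm) \<Rightarrow>
     complex \<Rightarrow> 'w \<Rightarrow> complex" where
  "feynman_kac_integrand T V f X \<theta> \<omega> =
     f (X T \<omega>) * exp (- \<theta> * complex_of_real (LINT t:{0..T}|lborel. V t (X t \<omega>)))"

definition feynman_kac ::
    "real \<Rightarrow> (real \<Rightarrow> 'm \<Rightarrow> real) \<Rightarrow> ('m \<Rightarrow> complex) \<Rightarrow> (real \<Rightarrow> 'm \<Rightarrow> 'w measure) \<Rightarrow>
     (real \<Rightarrow> 'w \<Rightarrow> 'm) \<Rightarrow> complex \<Rightarrow> 'm \<Rightarrow> complex" where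
  "feynman_kac T V f P X \<theta> x = (\<integral>\<omega>. feynman_kac_integrand T V f X \<theta> \<omega> \<partial>P 0 x)"

end

theory Submission
  imports Defs
begin

text \<open>Discretising time exhibits \<open>(t, \<omega>) \<mapsto> X t \<omega>\<close> as a pointwise limit of jointly measurable maps.
  The manifold carries no chosen metric, so the limit is handled through regularity of compact
  Hausdorff spaces: an open set is a countable union of open sets whose closures it contains.
  Fubini then makes the action \<open>Y = \<integral>\<^sub>0\<^sup>T V(t, X t) dt\<close> a random variable with \<open>\<bar>Y\<bar> \<le> C T\<close>, and
  \<open>E[f(X T) exp(- \<theta> Y)]\<close> may be expanded termwise into a power series in \<open>\<theta>\<close> that converges
  everywhere.\<close>

section \<open>Limits of measurable maps into a compact space, and continuous processes\<close>

lemma compact_space_open_nbhd_closure_subset: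
  fixes U :: "'a::t2_space set"
  assumes "compact (UNIV :: 'a set)" "open U" "x \<in> U"
  obtains W where "open W" "x \<in> W" "closure W \<subseteq> U"
proof -
  have "Hausdorff_space (euclidean :: 'a topology)"
    using hausdorff by (fastforce simp: Hausdorff_space_def disjnt_def)
  then have "regular_space (euclidean :: 'a topology)"
    using assms(1) by (intro compact_Hausdorff_imp_regular_space) (simp_all add: compact_space_def)
  then have "neighbourhood_base_of (closedin euclidean) (euclidean :: 'a topology)"
    by (simp add: neighbourhood_base_of_closedin)
  then obtain W C where "open W" "closed C" "x \<in> W" "W \<subseteq> C" "C \<subseteq> U"
    using assms(2,3) unfolding neighbourhood_base_of by (metis open_openin closed_closedin)
  then show thesis
    by (intro that[of W]) (auto dest: closure_minimal)
qed

text \<open>By regularity a point of \<open>U\<close> has a neighbourhood with closure inside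
  \<open>U\<close>. Shrinking it to a basis element shrinks the closure too, so the basis elements
  with closure inside \<open>U\<close> already cover \<open>U\<close>, and a second countable space
  has only countably many of them to offer.\<close>

lemma open_eq_countable_Union_closures:
  fixes U :: "'a::{t2_space,second_countable_topology} set"
  assumes "compact (UNIV :: 'a set)" "open U"
  obtains \<W> where "countable \<W>" "\<And>W. W \<in> \<W> \<Longrightarrow> open W \<and> closure W \<subseteq> U" "\<Union>\<W> = U"
proof -
  obtain B :: "'a set set" where B: "countable B" "topological_basis B"
    using ex_countable_basis by blast
  let ?W = "{W \<in> B. closure W \<subseteq> U}"
  show thesis
  proof (rule that[of ?W])
    show "countable ?W"
      using B(1) by simp
    show "open W \<and> closure W \<subseteq> U" if "W \<in> ?W" for W
      using that B(2) topological_basis_open by blast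
    show "\<Union>?W = U"
    proof (intro equalityI subsetI)
      fix x assume "x \<in> U"
      then obtain W where W: "open W" "x \<in> W" "closure W \<subseteq> U"
        using compact_space_open_nbhd_closure_subset assms by metis
      then obtain W' where "W' \<in> B" "x \<in> W'" "W' \<subseteq> W"
        using topological_basisE[OF B(2)] by metis
      then show "x \<in> \<Union>?W"
        using W(3) closure_mono[of W' W] by blast
    qed (use closure_subset in blast)
  qed
qed

text \<open>For metric targets the distance to a closed set settles this. Here the open sets with
  closure inside \<open>U\<close> take over: they leave the room that a limit needs to stay in
  \<open>U\<close>.\<close>

lemma borel_measurable_LIMSEQ_compact_space:
  fixes u :: "nat \<Rightarrow> 'b \<Rightarrow> 'a::{t2_space,second_countable_topology}"
  assumes "compact (UNIV :: 'a set)"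
    and lim: "\<And>x. x \<in> space M \<Longrightarrow> (\<lambda>n. u n x) \<longlonglongrightarrow> l x"
    and u: "\<And>n. u n \<in> borel_measurable M"
  shows "l \<in> borel_measurable M"
proof (rule borel_measurableI)
  fix U :: "'a set" assume "open U"
  then obtain \<W> where W: "countable \<W>" "\<And>W. W \<in> \<W> \<Longrightarrow> open W \<and> closure W \<subseteq> U" "\<Union>\<W> = U"
    using open_eq_countable_Union_closures[OF assms(1)] by metis
  \<comment> \<open>Convergence pushes a tail into any open \<open>W\<close> around the limit.
    Conversely, a tail in \<open>W\<close> places the limit only in \<open>closure W\<close>, which
    is why the closures have to lie in \<open>U\<close>.\<close>
  have "l x \<in> U \<longleftrightarrow> (\<exists>W\<in>\<W>. \<exists>m. \<forall>n\<ge>m. u n x \<in> W)" if x: "x \<in> space M" for x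
  proof
    assume "l x \<in> U"
    then obtain W where "W \<in> \<W>" "l x \<in> W"
      using W(3) by blast
    then show "\<exists>W\<in>\<W>. \<exists>m. \<forall>n\<ge>m. u n x \<in> W"
      using topological_tendstoD[OF lim[OF x], of W] W(2) by (auto simp: eventually_sequentially)
  next
    assume "\<exists>W\<in>\<W>. \<exists>m. \<forall>n\<ge>m. u n x \<in> W"
    then obtain W m where m: "W \<in> \<W>" "\<forall>n\<ge>m. u n x \<in> W"
      by blast
    then have "\<forall>\<^sub>F n in sequentially. u n x \<in> closure W"
      using closure_subset by (auto simp: eventually_sequentially)
    then have "l x \<in> closure W"
      by (intro Lim_in_closed_set[OF _ _ _ lim[OF x]]) auto
    then show "l x \<in> U"
      using W(2) m(1) by blast
  qed
  then have eq: "l -` U \<inter> space M = (\<Union>W\<in>\<W>. \<Union>m. {x \<in> space M. \<forall>n\<ge>m. u n x \<in> W})"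
    by auto
  have tail: "{x \<in> space M. \<forall>n\<ge>m. u n x \<in> W} \<in> sets M" if "W \<in> \<W>" for W m
  proof -
    have [measurable]: "W \<in> sets borel" and [measurable]: "\<And>n. u n \<in> borel_measurable M"
      using W(2) that u by auto
    show ?thesis
      by measurable
  qed
  have "(\<Union>m. {x \<in> space M. \<forall>n\<ge>m. u n x \<in> W}) \<in> sets M" if "W \<in> \<W>" for W
    by (rule sets.countable_UN''[OF countableI_type tail[OF that]])
  then show "l -` U \<inter> space M \<in> sets M"
    unfolding eq by (rule sets.countable_UN''[OF W(1)])
qed

text \<open>Rounding time down to a grid of mesh 1/(n+1) leaves countably many time slices, each
  measurable in \<omega> alone. Path continuity recovers the process as the mesh shrinks.\<close>

lemma continuous_process_jointly_measurable:
  fixes X :: "real \<Rightarrow> 'w \<Rightarrow> 'a::{t2_space,second_countable_topology}"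
  assumes "compact (UNIV :: 'a set)" "0 \<le> T"
    and X: "\<And>t. t \<in> {0..T} \<Longrightarrow> X t \<in> borel_measurable N"
    and cont: "\<And>\<omega>. \<omega> \<in> space N \<Longrightarrow> continuous_on {0..T} (\<lambda>t. X t \<omega>)"
  shows "(\<lambda>(t, \<omega>). X t \<omega>) \<in> borel_measurable (restrict_space borel {0..T} \<Otimes>\<^sub>M N)"
    (is "_ \<in> borel_measurable ?M")
proof -
  \<comment> \<open>Grid points are clamped to [0,T], so that every integer index \<open>k\<close>
    names a time at which \<open>X\<close> is known to be measurable.\<close>
  define d where "d n k = max 0 (min T (real_of_int k / real (Suc n)))" for n k
  define u where "u n = (\<lambda>z. X (d n \<lfloor>fst z * real (Suc n)\<rfloor>) (snd z))" for n
  have d: "d n k \<in> {0..T}" for n k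
    using \<open>0 \<le> T\<close> by (auto simp: d_def)
  have fst_meas [measurable]: "fst \<in> borel_measurable ?M"
    by (rule measurable_compose[OF measurable_fst]) (simp add: measurable_restrict_space1)
  have "u n \<in> borel_measurable ?M" for n
    unfolding u_def
  proof (rule measurable_compose_countable)
    show "(\<lambda>z. X (d n k) (snd z)) \<in> borel_measurable ?M" for k
      by (rule measurable_compose[OF measurable_snd X[OF d]])
    show "(\<lambda>z. \<lfloor>fst z * real (Suc n)\<rfloor>) \<in> measurable ?M (count_space UNIV)"
      by measurable
  qed
  moreover have lim: "(\<lambda>n. u n z) \<longlonglongrightarrow> X (fst z) (snd z)" if z: "z \<in> space ?M" for z
  proof -
    define t where "t = fst z"
    have t: "t \<in> {0..T}" and \<omega>: "snd z \<in> space N"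
      using z by (auto simp: t_def space_pair_measure space_restrict_space)
    \<comment> \<open>The rounded time satisfies both bounds before clamping, and clamping keeps
      them because \<open>t\<close> itself lies in [0,T].\<close>
    have bounds: "t - 1 / real (Suc n) \<le> d n \<lfloor>t * real (Suc n)\<rfloor>" "d n \<lfloor>t * real (Suc n)\<rfloor> \<le> t" for n
    proof -
      have "real_of_int \<lfloor>t * real (Suc n)\<rfloor> / real (Suc n) \<le> t"
        by (simp add: divide_le_eq del: of_nat_Suc)
      moreover have "t - 1 / real (Suc n) \<le> real_of_int \<lfloor>t * real (Suc n)\<rfloor> / real (Suc n)"
      proof -
        have "t * real (Suc n) - 1 \<le> real_of_int \<lfloor>t * real (Suc n)\<rfloor>"
          by linarith
        then have "(t * real (Suc n) - 1) / real (Suc n) \<le> real_of_int \<lfloor>t * real (Suc n)\<rfloor> / real (Suc n)"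
          by (rule divide_right_mono) simp
        then show ?thesis
          by (simp add: diff_divide_distrib del: of_nat_Suc)
      qed
      ultimately show "t - 1 / real (Suc n) \<le> d n \<lfloor>t * real (Suc n)\<rfloor>" "d n \<lfloor>t * real (Suc n)\<rfloor> \<le> t"
        using t by (auto simp: d_def)
    qed
    have "(\<lambda>n. t - 1 / real (Suc n)) \<longlonglongrightarrow> t - 0"
      using LIMSEQ_inverse_real_of_nat by (intro tendsto_diff tendsto_const) (simp add: inverse_eq_divide)
    then have lower: "(\<lambda>n. t - 1 / real (Suc n)) \<longlonglongrightarrow> t"
      by simp
    have "(\<lambda>n. d n \<lfloor>t * real (Suc n)\<rfloor>) \<longlonglongrightarrow> t"
      by (rule tendsto_sandwich[OF _ _ lower tendsto_const]) (intro always_eventually allI bounds)+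
    then show ?thesis
      unfolding u_def t_def[symmetric]
      by (rule continuous_on_tendsto_compose[OF cont[OF \<omega>] _ t]) (intro always_eventually allI d)
  qed
  ultimately have "(\<lambda>z. X (fst z) (snd z)) \<in> borel_measurable ?M"
    by (intro borel_measurable_LIMSEQ_compact_space[OF assms(1) lim])
  then show ?thesis
    by (simp add: case_prod_beta')
qed

section \<open>Laplace transforms of bounded random variables\<close>

lemma (in finite_measure) integrable_mult_exp_bounded:
  fixes h :: "'a \<Rightarrow> complex" and Y :: "'a \<Rightarrow> real"
  assumes [measurable]: "h \<in> borel_measurable M" "Y \<in> borel_measurable M"
    and h: "\<And>x. x \<in> space M \<Longrightarrow> norm (h x) \<le> B" and Y: "\<And>x. x \<in> space M \<Longrightarrow> \<bar>Y x\<bar> \<le> c"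
  shows "integrable M (\<lambda>x. h x * exp (- \<theta> * complex_of_real (Y x)))"
proof (rule integrable_const_bound[where B = "B * exp (norm \<theta> * c)"])
  show "AE x in M. norm (h x * exp (- \<theta> * complex_of_real (Y x))) \<le> B * exp (norm \<theta> * c)"
  proof (rule AE_I2)
    fix x assume x: "x \<in> space M"
    have "norm (exp (- \<theta> * complex_of_real (Y x))) \<le> exp (norm (- \<theta> * complex_of_real (Y x)))"
      by (rule norm_exp)
    also have "\<dots> \<le> exp (norm \<theta> * c)"
      using Y[OF x] by (simp add: norm_mult mult_left_mono)
    \<comment> \<open>The sign of \<open>B\<close> needed for multiplying the bounds comes from
      \<open>x\<close> itself: \<open>B\<close> dominates a norm there.\<close>
    finally show "norm (h x * exp (- \<theta> * complex_of_real (Y x))) \<le> B * exp (norm \<theta> * c)"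
      unfolding norm_mult using h[OF x] by (intro mult_mono) (auto intro: order_trans[OF norm_ge_zero])
  qed
qed measurable

text \<open>The Taylor coefficients at 0 are the moments of \<open>- Y\<close> weighted by
  \<open>h\<close> and divided by n!. Boundedness makes them decay like c^n / n!, hence the infinite
  radius of convergence.\<close>

lemma (in finite_measure) entire_laplace_transform_bounded:
  fixes h :: "'a \<Rightarrow> complex" and Y :: "'a \<Rightarrow> real"
  assumes [measurable]: "h \<in> borel_measurable M" "Y \<in> borel_measurable M"
    and h: "\<And>x. x \<in> space M \<Longrightarrow> norm (h x) \<le> B" and Y: "\<And>x. x \<in> space M \<Longrightarrow> \<bar>Y x\<bar> \<le> c"
    and "0 \<le> B" "0 \<le> c"
  shows "(\<lambda>\<theta>. \<integral>x. h x * exp (- \<theta> * complex_of_real (Y x)) \<partial>M) holomorphic_on UNIV"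
    (is "?F holomorphic_on UNIV")
proof -
  define a where "a n = (\<integral>x. h x * ((- complex_of_real (Y x)) ^ n /\<^sub>R fact n) \<partial>M)" for n
  have "(\<lambda>n. a n * (\<theta> - 0) ^ n) sums ?F \<theta>" for \<theta>
  proof -
    \<comment> \<open>Keeping \<theta> inside the term lets the series of B exp(|\<theta>| c)
      dominate uniformly in \<open>x\<close>. This one majorant serves both summability conditions
      for exchanging sum and integral.\<close>
    define k where "k n x = h x * ((- \<theta> * complex_of_real (Y x)) ^ n /\<^sub>R fact n)" for n x
    have k_meas [measurable]: "k n \<in> borel_measurable M" for n
      unfolding k_def by measurable
    have k_le: "norm (k n x) \<le> B * ((norm \<theta> * c) ^ n /\<^sub>R fact n)" if "x \<in> space M" for n x
    proof -
      have "(norm \<theta> * \<bar>Y x\<bar>) ^ n \<le> (norm \<theta> * c) ^ n"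
        using Y[OF that] by (intro power_mono mult_left_mono) auto
      then show ?thesis
        unfolding k_def using h[OF that] \<open>0 \<le> B\<close>
        by (auto simp: norm_mult norm_power intro!: mult_mono)
    qed
    have summ: "summable (\<lambda>n. B * ((norm \<theta> * c) ^ n /\<^sub>R fact n))"
      by (intro summable_mult summable_exp_generic)
    have int_k: "integrable M (k n)" for n
      by (rule integrable_const_bound[where B = "B * ((norm \<theta> * c) ^ n /\<^sub>R fact n)"])
         (use k_le in auto)
    have "(\<lambda>n. integral\<^sup>L M (k n)) sums (\<integral>x. (\<Sum>n. k n x) \<partial>M)"
    proof (rule sums_integral[OF int_k])
      show "AE x in M. summable (\<lambda>n. norm (k n x))"
        by (rule AE_I2, rule summable_comparison_test'[OF summ, of 0]) (use k_le in auto)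
      show "summable (\<lambda>n. \<integral>x. norm (k n x) \<partial>M)"
      proof (rule summable_comparison_test'[of "\<lambda>n. B * ((norm \<theta> * c) ^ n /\<^sub>R fact n) * measure M (space M)" 0])
        show "summable (\<lambda>n. B * ((norm \<theta> * c) ^ n /\<^sub>R fact n) * measure M (space M))"
          by (intro summable_mult2 summ)
        show "norm (\<integral>x. norm (k n x) \<partial>M) \<le> B * ((norm \<theta> * c) ^ n /\<^sub>R fact n) * measure M (space M)" for n
        proof -
          have "(\<integral>x. norm (k n x) \<partial>M) \<le> (\<integral>x. B * ((norm \<theta> * c) ^ n /\<^sub>R fact n) \<partial>M)"
            using k_le int_k by (intro integral_mono) auto
          then show ?thesis
            by (simp add: mult_ac)
        qed
      qed
    qed
    moreover have "integral\<^sup>L M (k n) = a n * (\<theta> - 0) ^ n" for n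
    proof -
      have "k n = (\<lambda>x. h x * ((- complex_of_real (Y x)) ^ n /\<^sub>R fact n) * \<theta> ^ n)"
      proof
        fix x
        have "(- \<theta> * complex_of_real (Y x)) ^ n = (- complex_of_real (Y x)) ^ n * \<theta> ^ n"
          by (subst power_mult_distrib[symmetric]) (simp add: mult.commute)
        then show "k n x = h x * ((- complex_of_real (Y x)) ^ n /\<^sub>R fact n) * \<theta> ^ n"
          unfolding k_def by (simp only: scaleR_conv_of_real mult_ac)
      qed
      then show ?thesis
        by (simp add: a_def)
    qed
    moreover have "(\<Sum>n. k n x) = h x * exp (- \<theta> * complex_of_real (Y x))" for x
      unfolding k_def exp_def by (intro suminf_mult summable_exp_generic)
    ultimately show ?thesis
      by simp
  qed
  then have "?F holomorphic_on ball 0 r" for r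
    by (rule power_series_holomorphic)
  \<comment> \<open>The radius |\<theta>| + 1 makes \<theta> an interior point of the ball.\<close>
  then have "?F field_differentiable at \<theta>" for \<theta>
    by (rule holomorphic_on_imp_differentiable_at[of _ "ball 0 (norm \<theta> + 1)"]) auto
  then show ?thesis
    by (simp add: holomorphic_on_def)
qed

section \<open>The action as a random variable and the Feynman-Kac expectation\<close>

theorem theorem4:
  fixes A :: "('m::{t2_space,second_countable_topology}, 'e::euclidean_space) chart set"
    and g :: "('m, 'e) metric"
    and \<gamma>\<^sub>0 :: "real \<Rightarrow> 'm" and p q :: 'm
    and T \<eta> \<sigma> :: real
    and K :: "'e set" and e :: "'e \<Rightarrow> real \<Rightarrow> ('m, 'e) tvec"
    and chi Ec :: "real \<Rightarrow> real"
    and N :: "'w measure" and P :: "real \<Rightarrow> 'm \<Rightarrow> 'w measure" and X :: "real \<Rightarrow> 'w \<Rightarrow> 'm"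
    and V\<^sub>E :: "real \<Rightarrow> 'm \<Rightarrow> real" and f :: "'m \<Rightarrow> complex"
  assumes "compact (UNIV :: 'm set)" and "smooth_atlas A" and "riemannian_metric A g"
    and "0 < T" and "C2_curve A \<gamma>\<^sub>0 {0..T}" and "\<gamma>\<^sub>0 0 = p" and "\<gamma>\<^sub>0 T = q"
    and "0 < \<eta>"
    and "parallel_frame A g \<gamma>\<^sub>0 T K e"
    and "0 < \<sigma>" and "barrier \<eta> Ec"
    and "tube_diffusion A g \<gamma>\<^sub>0 T \<eta> K e \<sigma> chi Ec N P X"
    and "(\<lambda>(t, x). V\<^sub>E t x) \<in> borel_measurable (restrict_space borel ({0..T} \<times> tube A g \<gamma>\<^sub>0 T \<eta>))"
    and "bdd_above ((\<lambda>(t, x). \<bar>V\<^sub>E t x\<bar>) ` ({0..T} \<times> tube A g \<gamma>\<^sub>0 T \<eta>))"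
    and "f \<in> borel_measurable (restrict_space borel (tube A g \<gamma>\<^sub>0 T \<eta>))"
    and "bounded (f ` tube A g \<gamma>\<^sub>0 T \<eta>)"
  shows "\<forall>x \<in> tube A g \<gamma>\<^sub>0 T \<eta>.
           (\<forall>\<omega>\<in>space (P 0 x). set_integrable lborel {0..T} (\<lambda>t. V\<^sub>E t (X t \<omega>))) \<and>
           (\<forall>\<theta>. integrable (P 0 x) (feynman_kac_integrand T V\<^sub>E f X \<theta>)) \<and>
           (\<exists>F. F holomorphic_on UNIV \<and> (\<forall>\<theta>. F \<theta> = feynman_kac T V\<^sub>E f P X \<theta> x))"
proof (intro ballI conjI allI)
  let ?S = "tube A g \<gamma>\<^sub>0 T \<eta>" and ?L = "restrict_space borel {0..T} :: real measure"
  have proc: "continuous_markov_process T ?S N P X"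
    using assms(12) by (simp add: tube_diffusion_def)
  have X: "\<And>t. t \<in> {0..T} \<Longrightarrow> X t \<in> borel_measurable N"
    and cont: "\<And>\<omega>. \<omega> \<in> space N \<Longrightarrow> continuous_on {0..T} (\<lambda>t. X t \<omega>)"
    and in_S: "\<And>t \<omega>. t \<in> {0..T} \<Longrightarrow> \<omega> \<in> space N \<Longrightarrow> X t \<omega> \<in> ?S"
    using proc by (auto simp: continuous_markov_process_def)
  obtain C where C: "\<And>t y. t \<in> {0..T} \<Longrightarrow> y \<in> ?S \<Longrightarrow> \<bar>V\<^sub>E t y\<bar> \<le> C"
    using assms(14) by (fastforce simp: bdd_above_def)
  obtain B where B: "\<And>y. y \<in> ?S \<Longrightarrow> norm (f y) \<le> B"
    using assms(16) by (auto simp: bounded_iff)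
  have X_joint: "(\<lambda>(t, \<omega>). X t \<omega>) \<in> borel_measurable (?L \<Otimes>\<^sub>M N)"
    using continuous_process_jointly_measurable[OF assms(1) _ X cont] assms(4) by simp
  have fst_meas: "fst \<in> borel_measurable (?L \<Otimes>\<^sub>M N)"
    by (rule measurable_compose[OF measurable_fst]) (simp add: measurable_restrict_space1)
  \<comment> \<open>\<open>V\<^sub>E\<close> is measurable only on [0,T] times the tube. The
    space-time map is therefore treated first as a map into the full product and then corestricted,
    since the paths stay in the tube.\<close>
  have "(\<lambda>z. (fst z, X (fst z) (snd z))) \<in> measurable (?L \<Otimes>\<^sub>M N) (borel \<Otimes>\<^sub>M borel)"
    using X_joint fst_meas by (intro measurable_Pair) (simp_all add: case_prod_beta')
  then have "(\<lambda>z. (fst z, X (fst z) (snd z))) \<in>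
      measurable (?L \<Otimes>\<^sub>M N) (restrict_space borel ({0..T} \<times> ?S))"
    unfolding borel_prod using in_S
    by (intro measurable_restrict_space2) (auto simp: space_pair_measure space_restrict_space)
  from measurable_compose[OF this assms(13)]
  have V_joint: "(\<lambda>(t, \<omega>). V\<^sub>E t (X t \<omega>)) \<in> borel_measurable (?L \<Otimes>\<^sub>M N)"
    by (simp add: case_prod_beta')
  have C_int: "set_integrable lborel {0..T} (\<lambda>_. C)"
    unfolding set_integrable_def
    by (intro integrable_scaleR_left integrable_real_indicator) (simp_all add: emeasure_lborel_Icc_eq)
  have V_int: "set_integrable lborel {0..T} (\<lambda>t. V\<^sub>E t (X t \<omega>))" if \<omega>: "\<omega> \<in> space N" for \<omega>
  proof -
    have "(\<lambda>t. V\<^sub>E t (X t \<omega>)) \<in> borel_measurable ?L"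
      using measurable_compose[OF measurable_Pair2'[OF \<omega>] V_joint] by simp
    then have "set_borel_measurable lborel {0..T} (\<lambda>t. V\<^sub>E t (X t \<omega>))"
      by (simp add: set_borel_measurable_def borel_measurable_restrict_space_iff)
    \<comment> \<open>Passing to \<open>norm C\<close> fits the domination rule and avoids a case
      distinction on the sign of \<open>C\<close>.\<close>
    moreover have "AE t in lborel. t \<in> {0..T} \<longrightarrow> norm (V\<^sub>E t (X t \<omega>)) \<le> norm C"
      using C[OF _ in_S[OF _ \<omega>]] by (intro AE_I2 impI) (fastforce intro: order_trans[OF _ abs_ge_self])
    ultimately show ?thesis
      by (rule set_integrable_bound[OF C_int])
  qed
  define Y where "Y \<omega> = (LINT t:{0..T}|lborel. V\<^sub>E t (X t \<omega>))" for \<omega>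
  \<comment> \<open>Measurability of a parameter integral calls for a sigma-finite measure in the
    integrated variable. Lebesgue measure on [0,T] is one, with the same measurable sets as
    \<open>?L\<close>.\<close>
  interpret L: sigma_finite_measure "restrict_space lborel {0..T} :: real measure"
    by (intro sigma_finite_measure_restrict_space lborel.sigma_finite_measure_axioms) simp
  have sets_L: "sets (restrict_space lborel {0..T}) = sets ?L"
    by (simp add: sets_restrict_space)
  have "(\<lambda>(\<omega>, t). V\<^sub>E t (X t \<omega>)) \<in> borel_measurable (N \<Otimes>\<^sub>M restrict_space lborel {0..T})"
    using measurable_pair_swap[OF V_joint]
    by (simp add: measurable_cong_sets[OF sets_pair_measure_cong[OF refl sets_L] refl])
  then have Y_meas: "Y \<in> borel_measurable N"
    unfolding Y_def set_lebesgue_integral_def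
    by (subst integral_restrict_space[symmetric]) (simp_all add: L.borel_measurable_lebesgue_integral)
  have Y_le: "\<bar>Y \<omega>\<bar> \<le> C * T" if \<omega>: "\<omega> \<in> space N" for \<omega>
  proof -
    have "norm (Y \<omega>) \<le> (LINT t:{0..T}|lborel. norm (V\<^sub>E t (X t \<omega>)))"
      unfolding Y_def by (rule set_integral_norm_bound[OF V_int[OF \<omega>]])
    also have "\<dots> \<le> (LINT t:{0..T}|lborel. C)"
      using C in_S[OF _ \<omega>] by (intro set_integral_mono set_integrable_norm V_int[OF \<omega>] C_int) auto
    also have "\<dots> = C * T"
      using assms(4) by (simp add: set_lebesgue_integral_def)
    finally show ?thesis
      by simp
  qed
  have "X T \<in> measurable N (restrict_space borel ?S)"
    using X in_S assms(4) by (intro measurable_restrict_space2) auto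
  from measurable_compose[OF this assms(15)]
  have f_meas: "(\<lambda>\<omega>. f (X T \<omega>)) \<in> borel_measurable N" .

  \<comment> \<open>Nothing above depends on the starting point. It enters through the law
    \<open>P 0 x\<close>, whose measurable sets are those of \<open>N\<close>, so the facts about
    \<open>N\<close> carry over.\<close>
  fix x assume x: "x \<in> ?S"
  have "0 \<in> {0..T}"
    using assms(4) by simp
  with proc x have prob_P: "prob_space (P 0 x)" and sets_P: "sets (P 0 x) = sets N"
    unfolding continuous_markov_process_def by blast+
  interpret prob_space "P 0 x"
    by (rule prob_P)
  have space_P: "space (P 0 x) = space N"
    using sets_P by (rule sets_eq_imp_space_eq)
  have meas: "(\<lambda>\<omega>. f (X T \<omega>)) \<in> borel_measurable (P 0 x)" "Y \<in> borel_measurable (P 0 x)"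
    using f_meas Y_meas by (simp_all add: measurable_cong_sets[OF sets_P refl])
  have f_le: "norm (f (X T \<omega>)) \<le> B" if "\<omega> \<in> space (P 0 x)" for \<omega>
    using B in_S that assms(4) by (simp add: space_P)
  have Y_le': "\<bar>Y \<omega>\<bar> \<le> C * T" if "\<omega> \<in> space (P 0 x)" for \<omega>
    using Y_le that by (simp add: space_P)
  \<comment> \<open>A probability space has a sample point, and evaluating the two bounds there
    shows that they are nonnegative.\<close>
  obtain \<omega>\<^sub>0 where \<omega>\<^sub>0: "\<omega>\<^sub>0 \<in> space (P 0 x)"
    using not_empty by blast
  have nonneg: "0 \<le> B" "0 \<le> C * T"
    using order_trans[OF norm_ge_zero f_le[OF \<omega>\<^sub>0]] order_trans[OF abs_ge_zero Y_le'[OF \<omega>\<^sub>0]] by auto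
  show "set_integrable lborel {0..T} (\<lambda>t. V\<^sub>E t (X t \<omega>))" if "\<omega> \<in> space (P 0 x)" for \<omega>
    using V_int that by (simp add: space_P)
  show "integrable (P 0 x) (feynman_kac_integrand T V\<^sub>E f X \<theta>)" for \<theta>
    using integrable_mult_exp_bounded[OF meas f_le Y_le']
    by (simp add: feynman_kac_integrand_def[abs_def] Y_def)
  show "\<exists>F. F holomorphic_on UNIV \<and> (\<forall>\<theta>. F \<theta> = feynman_kac T V\<^sub>E f P X \<theta> x)"
  \<comment> \<open>The expectation exists for every complex \<theta>, so it is its own entire
    extension.\<close>
  proof (intro exI conjI allI)
    show "(\<lambda>\<theta>. \<integral>\<omega>. f (X T \<omega>) * exp (- \<theta> * complex_of_real (Y \<omega>)) \<partial>P 0 x) holomorphic_on UNIV"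
      by (rule entire_laplace_transform_bounded[OF meas f_le Y_le' nonneg])
  qed (simp add: feynman_kac_def feynman_kac_integrand_def Y_def)
qed

end
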